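(* There exists a collection $\mathcal{F}$ of closed, convex subsets of the plane $\mathbb{R}^2$ such that (1) $\mathcal{F}$ has the $(4,3)$-property, (2) two of the elements of $\mathcal{F}$ are compact, and (3) $\tau(\mathcal{F}) = \infty$, i.e. $\mathcal{F}$ has no finite transversal.
   Context: A collection of sets $\mathcal{F}$ has the $(p,q)$-property if among every $p$ distinct members of $\mathcal{F}$ there are $q$ that have a point in common. A transversal of $\mathcal{F}$ is a set $A$ with $A \cap F \neq \emptyset$ for all $F \in \mathcal{F}$. The transversal (piercing) number $\tau(\mathcal{F})$ is the minimum cardinality of a transversal of $\mathcal{F}$, with $\tau(\mathcal{F}) = \infty$ if no finite transversal exists. *)

theory Defs
  imports "HOL-Analysis.Analysis"
begin

definition pq_property :: "nat \<Rightarrow> nat \<Rightarrow> 'a set set \<Rightarrow> bool" where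
  "pq_property p q \<F> \<longleftrightarrow>
     (\<forall>\<P> \<subseteq> \<F>. finite \<P> \<and> card \<P> = p \<longrightarrow>
        (\<exists>\<Q> \<subseteq> \<P>. card \<Q> = q \<and> \<Inter>\<Q> \<noteq> {}))"

definition transversal :: "'a set set \<Rightarrow> 'a set \<Rightarrow> bool" where
  "transversal \<F> A \<longleftrightarrow> (\<forall>F\<in>\<F>. A \<inter> F \<noteq> {})"

(* In enat the infimum of a nonempty set is its minimum, and the infimum of the empty set is
   infinity; only finite transversals are ranged over because card is 0 on infinite sets. *)
definition piercing_number :: "'a set set \<Rightarrow> enat" where
  "piercing_number \<F> = Inf {enat (card A) | A. finite A \<and> transversal \<F> A}"

lemma piercing_number_eq_infinity_iff:
  "piercing_number \<F> = \<infinity> \<longleftrightarrow> (\<nexists>A. finite A \<and> transversal \<F> A)"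
proof
  assume *: "piercing_number \<F> = \<infinity>"
  show "\<nexists>A. finite A \<and> transversal \<F> A"
  proof
    assume "\<exists>A. finite A \<and> transversal \<F> A"
    then obtain A where "finite A" "transversal \<F> A" by blast
    then have "piercing_number \<F> \<le> enat (card A)"
      unfolding piercing_number_def by (intro Inf_lower) blast
    with * show False by simp
  qed
next
  assume "\<nexists>A. finite A \<and> transversal \<F> A"
  then have "{enat (card A) | A. finite A \<and> transversal \<F> A} = {}" by blast
  then show "piercing_number \<F> = \<infinity>"
    unfolding piercing_number_def by (simp only: Inf_empty top_enat_def)
qed

end

(* Take thin wedges W n opening in the direction of the positive first axis, with apexes (0, 1/n)
   and widths shrinking so fast that W n meets that axis only from x = n on. Any finitely many
   wedges meet far out on the axis, but every point lies in only finitely many of them. All apexes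
   lie in both of two concentric discs, so each wedge has a point in common with the two discs. *)
theory Submission
  imports Defs
begin

text \<open>For \<open>n > 0\<close> this is the set \<bar>y - 1/n\<bar> \<le> x/n^2, multiplied by
  n^2 to avoid division; \<open>wedge 0\<close> is the half-plane x \<ge> 0.\<close>

definition wedge :: "nat \<Rightarrow> (real ^ 2) set" where
  "wedge n = {p. \<bar>(real n)\<^sup>2 * p $ 2 - real n\<bar> \<le> p $ 1}"

lemma closed_wedge: "closed (wedge n)"
  unfolding wedge_def by (intro closed_Collect_le continuous_intros)

lemma convex_wedge: "convex (wedge n)"
proof -
  have "wedge n = {p. inner (vector [-1, (real n)\<^sup>2]) p \<le> real n}
      \<inter> {p. inner (vector [-1, - (real n)\<^sup>2]) p \<le> - real n}"
    by (auto simp: wedge_def inner_vec_def sum_2 abs_le_iff)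
  then show ?thesis
    by (simp add: convex_Int convex_halfspace_le)
qed

(* For n = 0 the apex is the origin, since 1 / 0 = 0. *)
lemma apex_in_wedge: "vector [0, 1 / real n] \<in> wedge n"
  by (simp add: wedge_def power2_eq_square)

lemma norm_apex_le: "norm (vector [0, 1 / real n] :: real ^ 2) \<le> 1"
  by (cases n) (simp_all add: norm_vec_def L2_set_def sum_2 divide_simps)

lemma finite_wedges_intersect:
  assumes "finite I"
  shows "(\<Inter>n\<in>I. wedge n) \<noteq> {}"
proof -
  \<comment> \<open>On the axis, membership in \<open>wedge n\<close> reads n \<le> x. The sum
    bounds every index in \<open>I\<close>, and it covers the empty \<open>I\<close> as
    well.\<close>
  have "vector [real (\<Sum>I), 0] \<in> wedge n" if "n \<in> I" for n
    using member_le_sum[of n I "\<lambda>n. n"] assms that by (simp add: wedge_def del: of_nat_sum)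
  then show ?thesis by blast
qed

text \<open>On the axis, membership bounds n by x. Off the axis, n^2 y - n = n (n y - 1) outgrows x
  in absolute value.\<close>

lemma finite_wedges_through_point: "finite {n. p \<in> wedge n}"
proof (cases "p $ 2 = 0")
  case True
  then have "{n. p \<in> wedge n} \<subseteq> {..nat \<lfloor>p $ 1\<rfloor>}"
    by (auto simp: wedge_def le_nat_floor)
  then show ?thesis by (rule finite_subset) simp
next
  case False
  let ?x = "p $ 1" and ?y = "p $ 2"
  \<comment> \<open>The bound is chosen so that any larger n has \<bar>n y\<bar> - 1 >
    \<bar>x\<bar>.\<close>
  have "real n \<le> (\<bar>?x\<bar> + 1) / \<bar>?y\<bar>" if "p \<in> wedge n" for n
  proof (rule ccontr)
    assume *: "\<not> ?thesis"
    with False have "\<bar>?x\<bar> + 1 < real n * \<bar>?y\<bar>"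
      by (simp add: field_simps)
    moreover have "\<bar>real n * ?y\<bar> - 1 \<le> \<bar>real n * ?y - 1\<bar>"
      by linarith
    ultimately have less: "\<bar>?x\<bar> < \<bar>real n * ?y - 1\<bar>"
      by (simp add: abs_mult)
    have "n \<noteq> 0"
      using * by (intro notI) simp
    then have "1 * \<bar>real n * ?y - 1\<bar> \<le> real n * \<bar>real n * ?y - 1\<bar>"
      by (intro mult_right_mono) auto
    also have "\<dots> = \<bar>real n * (real n * ?y - 1)\<bar>"
      by (simp add: abs_mult)
    also have "\<dots> = \<bar>(real n)\<^sup>2 * ?y - real n\<bar>"
      by (simp add: power2_eq_square algebra_simps)
    also have "\<dots> \<le> ?x"
      using that by (simp add: wedge_def)
    finally show False using less by simp
  qed
  then have "{n. p \<in> wedge n} \<subseteq> {..nat \<lfloor>(\<bar>?x\<bar> + 1) / \<bar>?y\<bar>\<rfloor>}"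
    by (auto simp: le_nat_floor)
  then show ?thesis by (rule finite_subset) simp
qed

text \<open>Otherwise the finitely many points of \<open>A\<close> would split the naturals into
  finitely many finite index sets, possibly overlapping.\<close>

lemma no_finite_transversal_wedges:
  assumes "finite A"
  shows "\<not> transversal (range wedge) A"
proof
  assume "transversal (range wedge) A"
  then have "(UNIV :: nat set) = (\<Union>p\<in>A. {n. p \<in> wedge n})"
    by (auto simp: transversal_def)
  moreover have "finite (\<Union>p\<in>A. {n. p \<in> wedge n})"
    using assms finite_wedges_through_point by blast
  ultimately show False by simp
qed

text \<open>Among four members, either \<open>K\<close> and \<open>L\<close> both occur and go with
  any third one, or at least three lie in \<open>\<G>\<close>.\<close>

lemma pq_property_4_3_insert2:
  assumes three: "\<And>\<Q>. \<Q> \<subseteq> \<G> \<Longrightarrow> card \<Q> = 3 \<Longrightarrow> \<Inter>\<Q> \<noteq> {}"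
    and meets: "\<And>G. G \<in> \<G> \<Longrightarrow> K \<inter> L \<inter> G \<noteq> {}"
  shows "pq_property 4 3 (insert K (insert L \<G>))"
  unfolding pq_property_def
proof (intro allI impI)
  fix \<P> assume sub: "\<P> \<subseteq> insert K (insert L \<G>)" and "finite \<P> \<and> card \<P> = 4"
  then have fin: "finite \<P>" and card: "card \<P> = 4" by auto
  show "\<exists>\<Q>\<subseteq>\<P>. card \<Q> = 3 \<and> \<Inter>\<Q> \<noteq> {}"
  proof (cases "K \<noteq> L \<and> K \<in> \<P> \<and> L \<in> \<P>")
    case True
    then have "card (\<P> - {K, L}) = 2"
      using card by (subst card_Diff_subset) auto
    then have "\<P> - {K, L} \<noteq> {}" by force
    then obtain G where G: "G \<in> \<P>" "G \<noteq> K" "G \<noteq> L" by blast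
    then have "G \<in> \<G>" using sub by blast
    then have "\<Inter>{K, L, G} \<noteq> {}"
      using meets[of G] by (simp add: Int_assoc)
    moreover have "card {K, L, G} = 3" using True G by simp
    moreover have "{K, L, G} \<subseteq> \<P>" using True G by simp
    ultimately show ?thesis by (intro exI[of _ "{K, L, G}"] conjI)
  next
    case False
    \<comment> \<open>This singleton contains the intersection in each remaining case:
      \<open>K = L\<close>, \<open>K\<close> missing, or \<open>L\<close> missing.\<close>
    then have "card (\<P> \<inter> {K, L}) \<le> card {if K \<in> \<P> then K else L}"
      by (intro card_mono) auto
    then have "card (\<P> \<inter> {K, L}) \<le> 1" by simp
    then have "3 \<le> card (\<P> - {K, L})"
      using card fin by (simp add: card_Diff_subset_Int)
    then obtain \<Q> where \<Q>: "\<Q> \<subseteq> \<P> - {K, L}" "card \<Q> = 3"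
      by (rule obtain_subset_with_card_n)
    then have "\<Q> \<subseteq> \<G>" using sub by blast
    then have "\<Inter>\<Q> \<noteq> {}" using \<Q>(2) by (rule three)
    moreover have "\<Q> \<subseteq> \<P>" using \<Q>(1) by blast
    ultimately show ?thesis using \<Q>(2) by (intro exI[of _ \<Q>] conjI)
  qed
qed

theorem theorem1:
  "\<exists>\<F> :: (real ^ 2) set set.
     (\<forall>F\<in>\<F>. closed F \<and> convex F \<and> F \<noteq> {}) \<and>
     pq_property 4 3 \<F> \<and>
     (\<exists>K\<in>\<F>. \<exists>L\<in>\<F>. K \<noteq> L \<and> compact K \<and> compact L) \<and>
     piercing_number \<F> = \<infinity>"
proof -
  \<comment> \<open>Radius 1 already captures all apexes; the second radius differs to make the two
    compact members distinct.\<close>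
  let ?K = "cball 0 1 :: (real ^ 2) set" and ?L = "cball 0 2 :: (real ^ 2) set"
  let ?F = "insert ?K (insert ?L (range wedge))"
  have "\<forall>F\<in>?F. closed F \<and> convex F \<and> F \<noteq> {}"
    using apex_in_wedge by (auto simp: closed_wedge convex_wedge)
  moreover have "pq_property 4 3 ?F"
  proof (rule pq_property_4_3_insert2)
    fix \<Q> assume "\<Q> \<subseteq> range wedge" "card \<Q> = 3"
    \<comment> \<open>Since \<open>card\<close> is 0 on infinite sets, cardinality 3 forces
      finiteness, hence a finite index set.\<close>
    then obtain I where "finite I" "\<Q> = wedge ` I"
      by (metis card.infinite finite_subset_image zero_neq_numeral)
    then show "\<Inter>\<Q> \<noteq> {}" using finite_wedges_intersect by simp
  next
    fix G assume "G \<in> range wedge"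
    then obtain n where "G = wedge n" by blast
    then have "vector [0, 1 / real n] \<in> ?K \<inter> ?L \<inter> G"
      using apex_in_wedge[of n] norm_apex_le[of n] by simp
    then show "?K \<inter> ?L \<inter> G \<noteq> {}" by blast
  qed
  moreover have "?K \<noteq> ?L" by (simp add: cball_eq_cball_iff)
  \<comment> \<open>A transversal of the whole family also pierces the wedges.\<close>
  moreover have "piercing_number ?F = \<infinity>"
    using no_finite_transversal_wedges
    by (auto simp: piercing_number_eq_infinity_iff transversal_def)
  ultimately show ?thesis
    by (intro exI[of _ ?F]) (auto intro: compact_cball)
qed

end
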